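(* Let $(S,\mathcal{F})$ be a measurable space, let $\theta,\nu$ be probability measures on $(S,\mathcal{F})$, and let $g:S\to\mathbb{R}$ be any measurable function. (1) If $\alpha>1$, then $$\frac{1}{\alpha-1}\log\int_S e^{(\alpha-1)g}\,d\theta\leq\frac{1}{\alpha}\log\int_S e^{\alpha g}\,d\nu+R_\alpha(\theta\Vert\nu).$$ (2) If $\alpha>2$, then $$\frac{1}{\alpha-2}\log\int_S e^{(\alpha-2)g}\,d\nu-R_{\alpha-1}(\nu\Vert\theta)\leq\frac{1}{\alpha-1}\log\int_S e^{(\alpha-1)g}\,d\theta,$$ where on the left-hand side $\infty-\infty$ is interpreted as $-\infty$. Here $R_\alpha$ denotes the Rényi divergence of order $\alpha$, with the normalization $\frac{1}{\alpha(\alpha-1)}$; all quantities are allowed to take the value $+\infty$ (with $\log\infty=\infty$).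
   Context: Rényi divergence. For probability measures $\nu,\theta$ on $(S,\mathcal{F})$, let $\mu$ be any $\sigma$-finite measure on $(S,\mathcal{F})$ dominating both (i.e. $\nu\ll\mu$ and $\theta\ll\mu$; for instance $\mu=\nu+\theta$), and write $\nu'=\frac{d\nu}{d\mu}$, $\theta'=\frac{d\theta}{d\mu}$. For $\alpha>1$ (the only orders needed here), define $$R_\alpha(\nu\Vert\theta)=\begin{cases}\infty & \text{if }\nu\not\ll\theta,\\ \displaystyle\frac{1}{\alpha(\alpha-1)}\log\int_{\{\nu'\theta'>0\}}\Big(\frac{\nu'}{\theta'}\Big)^{\alpha}d\theta & \text{otherwise.}\end{cases}$$ The value does not depend on the choice of $\mu$ and lies in $[0,\infty]$. *)

theory Defs
  imports "HOL-Probability.Probability"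
begin

definition ln_ennreal :: "ennreal \<Rightarrow> ereal" where
  "ln_ennreal x = (if x = 0 then -\<infinity> else if x = \<infinity> then \<infinity> else ereal (ln (enn2real x)))"

text \<open>Subtraction on \<^typ>\<open>ereal\<close> with the convention \<open>\<infinity> - \<infinity> = -\<infinity>\<close>;
  the library subtraction has \<open>\<infinity> - \<infinity> = \<infinity>\<close>.\<close>

definition diff_minf :: "ereal \<Rightarrow> ereal \<Rightarrow> ereal" where
  "diff_minf a b = (if a = \<infinity> \<and> b = \<infinity> then -\<infinity> else a - b)"

text \<open>The Renyi divergence of \<open>\<nu>\<close> from \<open>\<theta>\<close> computed with a dominating measure \<open>\<mu>\<close>.
  Note that \<open>absolutely_continuous \<theta> \<nu>\<close> says that \<open>\<nu>\<close> is absolutely continuous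
  with respect to \<open>\<theta>\<close>. The densities are extended-valued,
  but finite almost everywhere, so \<^const>\<open>enn2real\<close> loses nothing.\<close>

definition renyi_wrt :: "'a measure \<Rightarrow> real \<Rightarrow> 'a measure \<Rightarrow> 'a measure \<Rightarrow> ereal" where
  "renyi_wrt \<mu> \<alpha> \<nu> \<theta> =
    (if \<not> absolutely_continuous \<theta> \<nu> then \<infinity>
     else ereal (1 / (\<alpha> * (\<alpha> - 1))) *
       ln_ennreal (\<integral>\<^sup>+ x \<in> {x \<in> space \<theta>. RN_deriv \<mu> \<nu> x * RN_deriv \<mu> \<theta> x > 0}.
          ennreal ((enn2real (RN_deriv \<mu> \<nu> x) / enn2real (RN_deriv \<mu> \<theta> x)) powr \<alpha>) \<partial>\<theta>))"

definition sum_measure :: "'a measure \<Rightarrow> 'a measure \<Rightarrow> 'a measure" where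
  "sum_measure M N = measure_of (space M) (sets M) (\<lambda>A. emeasure M A + emeasure N A)"

text \<open>The canonical choice \<open>\<mu> = \<nu> + \<theta>\<close>; lemma \<open>renyi_eq_renyi_wrt\<close> below shows that
  every other \<open>\<sigma>\<close>-finite dominating measure gives the same value.\<close>

definition renyi :: "real \<Rightarrow> 'a measure \<Rightarrow> 'a measure \<Rightarrow> ereal" where
  "renyi \<alpha> \<nu> \<theta> = renyi_wrt (sum_measure \<nu> \<theta>) \<alpha> \<nu> \<theta>"

lemma space_sum_measure [simp]: "space (sum_measure M N) = space M"
  and sets_sum_measure [simp, measurable_cong]: "sets (sum_measure M N) = sets M"
  by (simp_all add: sum_measure_def)

lemma emeasure_sum_measure:
  assumes "sets N = sets M" and "A \<in> sets M"
  shows "emeasure (sum_measure M N) A = emeasure M A + emeasure N A"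
  unfolding sum_measure_def
proof (rule emeasure_measure_of_sigma)
  show "sigma_algebra (space M) (sets M)" by (rule sets.sigma_algebra_axioms)
  show "positive (sets M) (\<lambda>A. emeasure M A + emeasure N A)" by (simp add: positive_def)
  show "countably_additive (sets M) (\<lambda>A. emeasure M A + emeasure N A)"
  proof (rule countably_additiveI)
    fix F :: "nat \<Rightarrow> 'a set"
    assume F: "range F \<subseteq> sets M" "disjoint_family F" "\<Union> (range F) \<in> sets M"
    have "(\<Sum>i. emeasure M (F i) + emeasure N (F i))
        = (\<Sum>i. emeasure M (F i)) + (\<Sum>i. emeasure N (F i))"
      by (rule suminf_add[symmetric]) auto
    also have "\<dots> = emeasure M (\<Union> (range F)) + emeasure N (\<Union> (range F))"
      using F assms(1) by (simp add: suminf_emeasure)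
    finally show "(\<Sum>i. emeasure M (F i) + emeasure N (F i))
        = emeasure M (\<Union> (range F)) + emeasure N (\<Union> (range F))" .
  qed
qed (use assms in auto)

lemma finite_measure_sum_measure:
  assumes "finite_measure M" "finite_measure N" "sets N = sets M"
  shows "finite_measure (sum_measure M N)"
proof
  interpret M: finite_measure M by fact
  interpret N: finite_measure N by fact
  show "emeasure (sum_measure M N) (space (sum_measure M N)) \<noteq> \<infinity>"
    using assms(3) by (simp add: emeasure_sum_measure M.emeasure_eq_measure N.emeasure_eq_measure)
qed

lemma absolutely_continuous_sum_measure:
  assumes "sets N = sets M"
  shows "absolutely_continuous (sum_measure M N) M" "absolutely_continuous (sum_measure M N) N"
  using assms by (auto simp: absolutely_continuous_def null_sets_def emeasure_sum_measure)

lemma renyi_wrt_eq: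
  assumes "prob_space \<nu>" "prob_space \<theta>" "sigma_finite_measure \<mu>"
    and sets: "sets \<nu> = sets \<mu>" "sets \<theta> = sets \<mu>"
    and ac: "absolutely_continuous \<mu> \<nu>" "absolutely_continuous \<mu> \<theta>"
  shows "renyi_wrt \<mu> \<alpha> \<nu> \<theta> =
    (if \<not> absolutely_continuous \<theta> \<nu> then \<infinity>
     else ereal (1 / (\<alpha> * (\<alpha> - 1))) *
       ln_ennreal (\<integral>\<^sup>+ x. ennreal (enn2real (RN_deriv \<theta> \<nu> x) powr \<alpha>) \<partial>\<theta>))"
proof (cases "absolutely_continuous \<theta> \<nu>")
  case True
  interpret \<nu>: prob_space \<nu> by fact
  interpret \<theta>: prob_space \<theta> by fact
  interpret \<mu>: sigma_finite_measure \<mu> by fact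
  let ?n = "RN_deriv \<mu> \<nu>" and ?t = "RN_deriv \<mu> \<theta>" and ?h = "RN_deriv \<theta> \<nu>"
  have [measurable_cong]: "sets \<theta> = sets \<mu>" "sets \<nu> = sets \<mu>" using sets by auto
  have hm[measurable]: "?h \<in> borel_measurable \<mu>"
    using borel_measurable_RN_deriv[of \<theta> \<nu>] by (simp cong: measurable_cong_sets add: sets)
  have t: "density \<mu> ?t = \<theta>" using ac sets by (intro \<mu>.density_RN_deriv) auto
  have "\<nu> = density \<theta> ?h" using True sets by (intro \<theta>.density_RN_deriv[symmetric]) auto
  also have "\<dots> = density (density \<mu> ?t) ?h" by (simp only: t)
  also have "\<dots> = density \<mu> (\<lambda>x. ?t x * ?h x)" by (rule density_density_eq) auto
  finally have "AE x in \<mu>. ?t x * ?h x = ?n x"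
    by (intro \<mu>.RN_deriv_unique) auto
  then have 1: "AE x in \<theta>. ?t x * ?h x = ?n x"
    by (rule absolutely_continuous_AE[OF sets(2) ac(2)])
  have "AE x in \<mu>. ?t x \<noteq> \<infinity>"
    by (rule \<mu>.RN_deriv_finite) (use sets ac \<theta>.sigma_finite_measure_axioms in auto)
  then have 2: "AE x in \<theta>. ?t x \<noteq> \<infinity>"
    by (rule absolutely_continuous_AE[OF sets(2) ac(2)])
  have "AE x in density \<mu> ?t. ?t x \<noteq> 0"
    by (subst AE_density) auto
  then have 3: "AE x in \<theta>. ?t x \<noteq> 0" by (simp only: t)
  have "(\<integral>\<^sup>+ x \<in> {x \<in> space \<theta>. ?n x * ?t x > 0}.
          ennreal ((enn2real (?n x) / enn2real (?t x)) powr \<alpha>) \<partial>\<theta>)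
      = (\<integral>\<^sup>+ x. ennreal (enn2real (?h x) powr \<alpha>) \<partial>\<theta>)"
  proof (rule nn_integral_cong_AE)
    show "AE x in \<theta>. ennreal ((enn2real (?n x) / enn2real (?t x)) powr \<alpha>) *
        indicator {x \<in> space \<theta>. 0 < ?n x * ?t x} x = ennreal (enn2real (?h x) powr \<alpha>)"
      using 1 2 3 AE_space
    proof eventually_elim
      case (elim x)
      then have "enn2real (?t x) \<noteq> 0" by (simp add: enn2real_eq_0_iff)
      moreover have "enn2real (?n x) = enn2real (?t x) * enn2real (?h x)"
        by (simp add: elim(1)[symmetric] enn2real_mult)
      ultimately have "enn2real (?n x) / enn2real (?t x) = enn2real (?h x)" by simp
      moreover have "0 < ?n x * ?t x \<longleftrightarrow> ?h x \<noteq> 0"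
        using elim by (simp add: zero_less_iff_neq_zero flip: elim(1))
      ultimately show ?case using elim(4) by (auto simp: indicator_def)
    qed
  qed
  then show ?thesis using True by (simp add: renyi_wrt_def)
qed (simp add: renyi_wrt_def)

lemma renyi_eq_renyi_wrt:
  assumes "prob_space \<nu>" "prob_space \<theta>" "sigma_finite_measure \<mu>"
    and "sets \<nu> = sets \<mu>" "sets \<theta> = sets \<mu>"
    and "absolutely_continuous \<mu> \<nu>" "absolutely_continuous \<mu> \<theta>"
  shows "renyi \<alpha> \<nu> \<theta> = renyi_wrt \<mu> \<alpha> \<nu> \<theta>"
proof -
  interpret \<nu>: prob_space \<nu> by fact
  interpret \<theta>: prob_space \<theta> by fact
  interpret s: finite_measure "sum_measure \<nu> \<theta>"
    by (rule finite_measure_sum_measure)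
      (use assms \<nu>.finite_measure_axioms \<theta>.finite_measure_axioms in auto)
  have "sets \<theta> = sets \<nu>" using assms by simp
  then show ?thesis
    unfolding renyi_def renyi_wrt_eq[OF assms]
    by (intro renyi_wrt_eq)
      (use assms absolutely_continuous_sum_measure[OF \<open>sets \<theta> = sets \<nu>\<close>] s.sigma_finite_measure_axioms in auto)
qed

end

theory Submission
  imports Defs
begin

text \<open>
  Part (1) is Hoelder's inequality with exponents \<open>\<alpha> / (\<alpha> - 1)\<close> and \<open>\<alpha>\<close>, applied under \<open>\<nu>\<close> to the product
  of \<open>exp ((\<alpha> - 1) * g)\<close> and the density of \<open>\<theta>\<close> with respect to \<open>\<nu>\<close>. Part (2) is part (1) with
  the two measures exchanged and \<open>\<alpha> - 1\<close> in place of \<open>\<alpha>\<close>.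
\<close>

text \<open>Divided by their integrals, \<open>f\<close> and \<open>h\<close> have total mass 1, so
  the pointwise Young bound with weights \<open>p\<close> and \<open>q\<close> integrates to
  \<open>p + q = 1\<close>. Weights replace conjugate exponents so that \<open>A\<close> and
  \<open>B\<close> are the plain integrals of \<open>f\<close> and \<open>h\<close>, the form in
  which both integrals occur in \<open>log_exp_integral_le_renyi\<close>.\<close>

lemma nn_integral_powr_Holder:
  fixes f h :: "'a \<Rightarrow> real"
  assumes [measurable]: "f \<in> borel_measurable M" "h \<in> borel_measurable M"
    and nonneg: "\<And>x. 0 \<le> f x" "\<And>x. 0 \<le> h x"
    and pq: "0 \<le> p" "0 \<le> q" "p + q = 1"
    and f: "(\<integral>\<^sup>+ x. ennreal (f x) \<partial>M) = ennreal A" and A: "0 < A"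
    and h: "(\<integral>\<^sup>+ x. ennreal (h x) \<partial>M) = ennreal B" and B: "0 < B"
  shows "(\<integral>\<^sup>+ x. ennreal (f x powr p * h x powr q) \<partial>M) \<le> ennreal (A powr p * B powr q)"
proof -
  let ?C = "A powr p * B powr q"
  have "(\<integral>\<^sup>+ x. ennreal (f x powr p * h x powr q) \<partial>M)
      \<le> (\<integral>\<^sup>+ x. ennreal (?C * (p / A)) * ennreal (f x) + ennreal (?C * (q / B)) * ennreal (h x) \<partial>M)"
  proof (rule nn_integral_mono)
    fix x
    have "f x powr p * h x powr q = ?C * ((f x / A) powr p * (h x / B) powr q)"
      using A B nonneg by (simp add: powr_divide)
    also have "\<dots> \<le> ?C * (p * (f x / A) + q * (h x / B))"
    proof (intro mult_left_mono)
      show "(f x / A) powr p * (h x / B) powr q \<le> p * (f x / A) + q * (h x / B)"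
      proof (cases "f x = 0 \<or> h x = 0")
        \<comment> \<open>Young's inequality is used only for positive bases. At a zero of
          \<open>f\<close> or \<open>h\<close> the left side is 0, even for a zero exponent, because
          \<open>0 powr p = 0\<close> for every \<open>p\<close>.\<close>
        case True
        then show ?thesis using A B nonneg pq by auto
      next
        case False
        then show ?thesis
          using A B nonneg pq by (intro Youngs_inequality_0) (auto simp: less_le)
      qed
    qed simp
    also have "\<dots> = (?C * (p / A)) * f x + (?C * (q / B)) * h x"
      by (simp add: algebra_simps)
    finally have "ennreal (f x powr p * h x powr q)
        \<le> ennreal ((?C * (p / A)) * f x + (?C * (q / B)) * h x)"
      by (rule ennreal_leI)
    also have "\<dots> = ennreal (?C * (p / A)) * ennreal (f x) + ennreal (?C * (q / B)) * ennreal (h x)"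
      using A B nonneg pq by (simp add: ennreal_plus ennreal_mult del: times_divide_eq_right times_divide_eq_left)
    finally show "ennreal (f x powr p * h x powr q)
        \<le> ennreal (?C * (p / A)) * ennreal (f x) + ennreal (?C * (q / B)) * ennreal (h x)" .
  qed
  also have "\<dots> = ennreal (?C * (p / A)) * ennreal A + ennreal (?C * (q / B)) * ennreal B"
    by (simp add: nn_integral_add nn_integral_cmult f h)
  also have "\<dots> = ennreal (?C * (p / A) * A + ?C * (q / B) * B)"
    using A B pq by (simp flip: ennreal_mult ennreal_plus)
  also have "?C * (p / A) * A + ?C * (q / B) * B = ?C * (p + q)"
    using A B by (simp add: algebra_simps)
  finally show ?thesis using pq by simp
qed

lemma ln_ennreal_eq_minus_infinity_iff [simp]: "ln_ennreal x = -\<infinity> \<longleftrightarrow> x = 0"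
  by (simp add: ln_ennreal_def)

lemma ln_ennreal_ennreal: "0 < x \<Longrightarrow> ln_ennreal (ennreal x) = ereal (ln x)"
  by (simp add: ln_ennreal_def)

lemma ln_ennreal_mono: "x \<le> y \<Longrightarrow> ln_ennreal x \<le> ln_ennreal y"
  by (cases x; cases y) (auto simp: ln_ennreal_def top_unique)

lemma nn_integral_exp_neq_0:
  fixes f :: "'a \<Rightarrow> real"
  assumes "prob_space M" "f \<in> borel_measurable M"
  shows "(\<integral>\<^sup>+ x. ennreal (exp (f x)) \<partial>M) \<noteq> 0"
proof -
  interpret prob_space M by fact
  show ?thesis using assms(2) by (simp add: nn_integral_0_iff_AE)
qed

text \<open>Taking the sum measure as dominating measure in \<open>renyi_wrt_eq\<close> makes it
  disappear from the formula. From here on only the density of \<nu> with respect to \<theta>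
  matters.\<close>

lemma renyi_eq:
  assumes "prob_space \<nu>" "prob_space \<theta>" "sets \<nu> = sets \<theta>"
  shows "renyi \<alpha> \<nu> \<theta> =
    (if \<not> absolutely_continuous \<theta> \<nu> then \<infinity>
     else ereal (1 / (\<alpha> * (\<alpha> - 1))) *
       ln_ennreal (\<integral>\<^sup>+ x. ennreal (enn2real (RN_deriv \<theta> \<nu> x) powr \<alpha>) \<partial>\<theta>))"
proof -
  interpret \<nu>: prob_space \<nu> by fact
  interpret \<theta>: prob_space \<theta> by fact
  interpret s: finite_measure "sum_measure \<nu> \<theta>"
    by (rule finite_measure_sum_measure)
      (use assms \<nu>.finite_measure_axioms \<theta>.finite_measure_axioms in auto)
  show ?thesis
    unfolding renyi_def
    by (rule renyi_wrt_eq)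
      (use assms absolutely_continuous_sum_measure[of \<theta> \<nu>] s.sigma_finite_measure_axioms in auto)
qed

context
  fixes \<nu> \<theta> :: "'a measure"
  assumes \<nu>: "prob_space \<nu>" and \<theta>: "prob_space \<theta>" and sets_eq: "sets \<nu> = sets \<theta>"
    and ac: "absolutely_continuous \<theta> \<nu>"
begin

text \<open>The density is finite almost everywhere because \<nu> is sigma-finite, so
  \<open>enn2real\<close> changes it only on a null set. The real-valued version is the one whose
  powers enter the divergence.\<close>

lemma nn_integral_eq_enn2real_RN_deriv:
  fixes f :: "'a \<Rightarrow> ennreal"
  assumes f: "f \<in> borel_measurable \<theta>"
  shows "(\<integral>\<^sup>+ x. f x \<partial>\<nu>) = (\<integral>\<^sup>+ x. ennreal (enn2real (RN_deriv \<theta> \<nu> x)) * f x \<partial>\<theta>)"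
proof -
  interpret \<nu>: prob_space \<nu> by (rule \<nu>)
  interpret \<theta>: prob_space \<theta> by (rule \<theta>)
  have "AE x in \<theta>. RN_deriv \<theta> \<nu> x \<noteq> \<infinity>"
    by (rule \<theta>.RN_deriv_finite[OF \<nu>.sigma_finite_measure_axioms ac sets_eq])
  then have "(\<integral>\<^sup>+ x. RN_deriv \<theta> \<nu> x * f x \<partial>\<theta>)
      = (\<integral>\<^sup>+ x. ennreal (enn2real (RN_deriv \<theta> \<nu> x)) * f x \<partial>\<theta>)"
    by (intro nn_integral_cong_AE) (auto elim!: eventually_mono simp: less_top)
  then show ?thesis
    by (simp add: \<theta>.RN_deriv_nn_integral[OF ac sets_eq f])
qed

text \<open>A real power vanishes only where its base does. If the integral were 0, the density
  would be 0 almost everywhere and \<nu> would have total mass 0 instead of 1.\<close>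

lemma nn_integral_RN_deriv_powr_neq_0:
  "(\<integral>\<^sup>+ x. ennreal (enn2real (RN_deriv \<theta> \<nu> x) powr \<alpha>) \<partial>\<theta>) \<noteq> 0"
proof
  interpret \<nu>: prob_space \<nu> by (rule \<nu>)
  assume "(\<integral>\<^sup>+ x. ennreal (enn2real (RN_deriv \<theta> \<nu> x) powr \<alpha>) \<partial>\<theta>) = 0"
  then have "AE x in \<theta>. ennreal (enn2real (RN_deriv \<theta> \<nu> x)) * 1 = 0"
    by (subst (asm) nn_integral_0_iff_AE) (auto elim!: eventually_mono simp: ennreal_eq_0_iff)
  then have "(\<integral>\<^sup>+ x. ennreal (enn2real (RN_deriv \<theta> \<nu> x)) * 1 \<partial>\<theta>) = (\<integral>\<^sup>+ x. 0 \<partial>\<theta>)"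
    by (rule nn_integral_cong_AE)
  then show False
    using nn_integral_eq_enn2real_RN_deriv[of "\<lambda>_. 1"] by (simp add: \<nu>.emeasure_space_1)
qed

end

text \<open>This weak form of nonnegativity is what \<open>diff_minf_leI\<close> requires for moving
  the divergence to the other side of an inequality.\<close>

lemma renyi_neq_minus_infinity:
  assumes "prob_space \<nu>" "prob_space \<theta>" "sets \<nu> = sets \<theta>" and "\<alpha> > 1"
  shows "renyi \<alpha> \<nu> \<theta> \<noteq> -\<infinity>"
proof (cases "absolutely_continuous \<theta> \<nu>")
  case True
  then have "ln_ennreal (\<integral>\<^sup>+ x. ennreal (enn2real (RN_deriv \<theta> \<nu> x) powr \<alpha>) \<partial>\<theta>) \<noteq> -\<infinity>"
    using assms by (simp add: nn_integral_RN_deriv_powr_neq_0)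
  then show ?thesis
    using True \<open>\<alpha> > 1\<close>
    by (cases "ln_ennreal (\<integral>\<^sup>+ x. ennreal (enn2real (RN_deriv \<theta> \<nu> x) powr \<alpha>) \<partial>\<theta>)")
      (simp_all add: renyi_eq[OF assms(1-3)])
qed (simp add: renyi_eq[OF assms(1-3)])

text \<open>Both parts of the theorem are instances: the first has the two measures in exchanged
  roles, the second has order \<open>\<alpha> - 1\<close>.\<close>

lemma log_exp_integral_le_renyi:
  fixes g :: "'a \<Rightarrow> real"
  assumes \<nu>: "prob_space \<nu>" and \<theta>: "prob_space \<theta>" and sets: "sets \<nu> = sets \<theta>"
    and g [measurable]: "g \<in> borel_measurable \<theta>" and \<alpha>: "\<alpha> > 1"
  shows "ereal (1 / (\<alpha> - 1)) * ln_ennreal (\<integral>\<^sup>+ x. ennreal (exp ((\<alpha> - 1) * g x)) \<partial>\<nu>)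
       \<le> ereal (1 / \<alpha>) * ln_ennreal (\<integral>\<^sup>+ x. ennreal (exp (\<alpha> * g x)) \<partial>\<theta>) + renyi \<alpha> \<nu> \<theta>"
    (is "?L \<le> ereal (1 / \<alpha>) * ln_ennreal ?E + _")
proof -
  let ?h = "\<lambda>x. enn2real (RN_deriv \<theta> \<nu> x)"
  let ?H = "\<integral>\<^sup>+ x. ennreal (?h x powr \<alpha>) \<partial>\<theta>"
  note renyi = renyi_eq[OF \<nu> \<theta> sets, of \<alpha>]
  have E0: "?E \<noteq> 0" by (rule nn_integral_exp_neq_0[OF \<theta>]) simp
  have "renyi \<alpha> \<nu> \<theta> = \<infinity>" if "\<not> absolutely_continuous \<theta> \<nu> \<or> ?H = \<infinity>"
    using \<alpha> that by (auto simp: renyi ln_ennreal_def)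
  \<comment> \<open>In the case \<open>top\<close> one summand on the right is \<infinity>, and
    \<open>ereal\<close> addition then gives \<infinity> whatever the other summand is. Otherwise
    both integrals on the right are finite and nonzero, so their logarithms are real.\<close>
  then consider (top) "?E = \<infinity> \<or> renyi \<alpha> \<nu> \<theta> = \<infinity>"
    | (finite) "?E \<noteq> \<infinity>" "absolutely_continuous \<theta> \<nu>" "?H \<noteq> \<infinity>"
    by blast
  then show ?thesis
  proof cases
    case top
    then show ?thesis using \<alpha> by (auto simp: ln_ennreal_def)
  next
    case finite
    have H0: "?H \<noteq> 0" by (rule nn_integral_RN_deriv_powr_neq_0[OF \<nu> \<theta> sets finite(2)])
    obtain A where A: "0 < A" "?E = ennreal A"
      using E0 finite by (cases ?E) (auto simp: ennreal_eq_0_iff less_le)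
    obtain B where B: "0 < B" "?H = ennreal B"
      using H0 finite by (cases ?H) (auto simp: ennreal_eq_0_iff less_le)
    let ?p = "(\<alpha> - 1) / \<alpha>" and ?q = "1 / \<alpha>"
    have "(\<integral>\<^sup>+ x. ennreal (exp ((\<alpha> - 1) * g x)) \<partial>\<nu>)
        = (\<integral>\<^sup>+ x. ennreal (?h x) * ennreal (exp ((\<alpha> - 1) * g x)) \<partial>\<theta>)"
      by (rule nn_integral_eq_enn2real_RN_deriv[OF \<nu> \<theta> sets finite(2)]) simp
    \<comment> \<open>The exponents undo the powers: \<open>exp (\<alpha> * g x)\<close> to the
      power \<open>?p\<close> is \<open>exp ((\<alpha> - 1) * g x)\<close>, and
      \<open>?h x powr \<alpha>\<close> to the power \<open>?q\<close> is
      \<open>?h x\<close>.\<close>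
    also have "\<dots> = (\<integral>\<^sup>+ x. ennreal (exp (\<alpha> * g x) powr ?p * (?h x powr \<alpha>) powr ?q) \<partial>\<theta>)"
      using \<alpha> by (intro nn_integral_cong) (simp add: exp_powr_real powr_powr ennreal_mult mult.commute)
    also have "\<dots> \<le> ennreal (A powr ?p * B powr ?q)"
      using \<alpha> A B by (intro nn_integral_powr_Holder) (auto simp: field_simps)
    finally have "?L \<le> ereal (1 / (\<alpha> - 1)) * ln_ennreal (ennreal (A powr ?p * B powr ?q))"
      using \<alpha> by (intro ereal_mult_left_mono ln_ennreal_mono) auto
    also have "\<dots> = ereal (1 / (\<alpha> - 1) * (?p * ln A + ?q * ln B))"
      using A B by (simp add: ln_ennreal_ennreal ln_mult ln_powr)
    \<comment> \<open>Dividing by \<open>\<alpha> - 1\<close> turns \<open>?p\<close> into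
      \<open>1 / \<alpha>\<close> and \<open>?q\<close> into
      \<open>1 / (\<alpha> * (\<alpha> - 1))\<close>, which is exactly the normalization of the
      divergence.\<close>
    also have "\<dots> = ereal (1 / \<alpha>) * ln_ennreal ?E + renyi \<alpha> \<nu> \<theta>"
      using \<alpha> A B finite(2) by (simp add: renyi ln_ennreal_ennreal divide_simps)
    finally show ?thesis .
  qed
qed

text \<open>For finite \<open>c\<close> this is ordinary rearrangement. For
  \<open>c = \<infinity>\<close> the hypothesis carries no information, but the difference is
  -\<infinity> for every \<open>a\<close>; when \<open>a = \<infinity>\<close> this is the
  convention built into \<open>diff_minf\<close>.\<close>

lemma diff_minf_leI: "c \<noteq> -\<infinity> \<Longrightarrow> a \<le> b + c \<Longrightarrow> diff_minf a c \<le> b"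
  by (cases a; cases b; cases c) (auto simp: diff_minf_def)

theorem corollary2p4:
  fixes M :: "'a measure" and \<theta> \<nu> :: "'a measure" and g :: "'a \<Rightarrow> real" and \<alpha> :: real
  assumes "prob_space \<theta>" and "sets \<theta> = sets M"
    and "prob_space \<nu>" and "sets \<nu> = sets M"
    and "g \<in> borel_measurable M"
  shows
    "(\<alpha> > 1 \<longrightarrow>
       ereal (1 / (\<alpha> - 1)) * ln_ennreal (\<integral>\<^sup>+ x. ennreal (exp ((\<alpha> - 1) * g x)) \<partial>\<theta>)
       \<le> ereal (1 / \<alpha>) * ln_ennreal (\<integral>\<^sup>+ x. ennreal (exp (\<alpha> * g x)) \<partial>\<nu>) + renyi \<alpha> \<theta> \<nu>)
   \<and> (\<alpha> > 2 \<longrightarrow>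
       diff_minf
         (ereal (1 / (\<alpha> - 2)) * ln_ennreal (\<integral>\<^sup>+ x. ennreal (exp ((\<alpha> - 2) * g x)) \<partial>\<nu>))
         (renyi (\<alpha> - 1) \<nu> \<theta>)
       \<le> ereal (1 / (\<alpha> - 1)) * ln_ennreal (\<integral>\<^sup>+ x. ennreal (exp ((\<alpha> - 1) * g x)) \<partial>\<theta>))"
proof (intro conjI impI)
  have sets: "sets \<theta> = sets \<nu>" using assms by simp
  have g: "g \<in> borel_measurable \<theta>" "g \<in> borel_measurable \<nu>"
    using assms by (simp_all cong: measurable_cong_sets)
  show "ereal (1 / (\<alpha> - 1)) * ln_ennreal (\<integral>\<^sup>+ x. ennreal (exp ((\<alpha> - 1) * g x)) \<partial>\<theta>)
       \<le> ereal (1 / \<alpha>) * ln_ennreal (\<integral>\<^sup>+ x. ennreal (exp (\<alpha> * g x)) \<partial>\<nu>) + renyi \<alpha> \<theta> \<nu>"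
    if "\<alpha> > 1"
    by (rule log_exp_integral_le_renyi[OF assms(1,3) sets g(2) that])
  show "diff_minf
         (ereal (1 / (\<alpha> - 2)) * ln_ennreal (\<integral>\<^sup>+ x. ennreal (exp ((\<alpha> - 2) * g x)) \<partial>\<nu>))
         (renyi (\<alpha> - 1) \<nu> \<theta>)
       \<le> ereal (1 / (\<alpha> - 1)) * ln_ennreal (\<integral>\<^sup>+ x. ennreal (exp ((\<alpha> - 1) * g x)) \<partial>\<theta>)"
    if "\<alpha> > 2"
  proof (rule diff_minf_leI)
    show "renyi (\<alpha> - 1) \<nu> \<theta> \<noteq> -\<infinity>"
      using renyi_neq_minus_infinity[OF assms(3,1) sets[symmetric]] that by simp
    have "\<alpha> - 1 - 1 = \<alpha> - 2" by simp
    then show "ereal (1 / (\<alpha> - 2)) * ln_ennreal (\<integral>\<^sup>+ x. ennreal (exp ((\<alpha> - 2) * g x)) \<partial>\<nu>)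
       \<le> ereal (1 / (\<alpha> - 1)) * ln_ennreal (\<integral>\<^sup>+ x. ennreal (exp ((\<alpha> - 1) * g x)) \<partial>\<theta>)
         + renyi (\<alpha> - 1) \<nu> \<theta>"
      using log_exp_integral_le_renyi[OF assms(3,1) sets[symmetric] g(1), of "\<alpha> - 1"] that by simp
  qed
qed

end
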